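(* For every fixed integer $k\ge 3$, there is a constant $c_k>0$ such that $f(s,k)\ge g(k)+\frac{c_k}{s}$ for all $s\ge 1$; that is, $f(s,k)\ge g(k)+\Theta(\frac1s)$.
   Context: Let $\Sigma_s=\{0,\ldots,s-1\}$ with its natural order. For a word $w$ (sequence), subwords are subsequences counted by position sets, monotone if non-decreasing or non-increasing; $m(k,w)$ is the number of monotone $k$-subwords. $f(s,k,n)=\min_{w\in(\Sigma_s)^n}m(k,w)/\binom nk$, $f(s,k)=\lim_{n\to\infty}f(s,k,n)$. $g(k,n)$ is the minimum over permutations $\pi$ of $[n]$ of $m(k,\pi)/\binom nk$, and $g(k)=\lim_{n\to\infty}g(k,n)$. *)

theory Defs
  imports Complex_Main "HOL-Combinatorics.Multiset_Permutations"
begin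

(* A subword is identified with its set of positions, so a constant subword,
   which is both non-decreasing and non-increasing, is counted once. *)
definition mono_subwords :: "nat \<Rightarrow> nat list \<Rightarrow> nat" where
  "mono_subwords k w =
     card {I. I \<subseteq> {..<length w} \<and> card I = k \<and> (mono_on I ((!) w) \<or> antimono_on I ((!) w))}"

definition words :: "nat \<Rightarrow> nat \<Rightarrow> nat list set" where
  "words s n = {w. set w \<subseteq> {0..<s} \<and> length w = n}"

definition f_fin :: "nat \<Rightarrow> nat \<Rightarrow> nat \<Rightarrow> real" where
  "f_fin s k n = Min ((\<lambda>w. real (mono_subwords k w) / real (n choose k)) ` words s n)"

definition f_lim :: "nat \<Rightarrow> nat \<Rightarrow> real" where
  "f_lim s k = lim (\<lambda>n. f_fin s k n)"

(* Permutations of [n] in one-line notation. *)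
definition g_fin :: "nat \<Rightarrow> nat \<Rightarrow> real" where
  "g_fin k n = Min ((\<lambda>w. real (mono_subwords k w) / real (n choose k)) ` permutations_of_set {1..n})"

definition g_lim :: "nat \<Rightarrow> real" where
  "g_lim k = lim (\<lambda>n. g_fin k n)"

end

theory Submission
  imports Defs "HOL-Library.Ramsey" "HOL-Library.Product_Lexorder"
begin

text \<open>
  Breaking ties between equal letters turns a word into a permutation and creates no new monotone
  set, so it is enough to destroy a \<open>c / s\<close> fraction of all \<open>k\<close>-sets. By Ramsey's theorem, some \<open>M\<close> is
  such that any \<open>M\<close> positions contain a monotone \<open>(k - 1)\<close>-set. Cut \<open>n = 2 s t M\<close> positions into \<open>M\<close>
  blocks of length \<open>2 s t\<close>. As there are only \<open>s\<close> letters, at least \<open>s t\<close> positions of each block have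
  \<open>t\<close> twins, that is, other positions in the same block with the same letter. Every choice of one such
  position per block contains a monotone \<open>(k - 1)\<close>-set, so there are at least \<open>(s t) ^ (k - 1)\<close> monotone
  \<open>(k - 1)\<close>-sets that meet each block at most once and whose elements have \<open>t\<close> twins each. Adding a
  twin keeps such a set monotone, which makes of order \<open>(s t) ^ (k - 1) * t\<close>, hence \<open>n ^ k / s\<close>,
  monotone \<open>k\<close>-sets. None of them survives both of two tie-breaking rules that agree between blocks
  and disagree inside them, so one of the rules destroys half of them.
\<close>

section \<open>Monotone sets of positions\<close>

definition mono_or_antimono_on :: "'a::linorder set \<Rightarrow> ('a \<Rightarrow> 'b::linorder) \<Rightarrow> bool" where
  "mono_or_antimono_on I h \<longleftrightarrow> mono_on I h \<or> antimono_on I h"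

definition mono_sets :: "nat \<Rightarrow> 'a::linorder set \<Rightarrow> ('a \<Rightarrow> 'b::linorder) \<Rightarrow> 'a set set" where
  "mono_sets k A h = {I \<in> nsets A k. mono_or_antimono_on I h}"

definition mono_density :: "nat \<Rightarrow> 'a::linorder set \<Rightarrow> ('a \<Rightarrow> 'b::linorder) \<Rightarrow> real" where
  "mono_density k A h = real (card (mono_sets k A h)) / real (card A choose k)"

lemma mono_or_antimono_on_order_preserving:
  assumes "mono_or_antimono_on I h"
    and "\<And>x y. x \<in> I \<Longrightarrow> y \<in> I \<Longrightarrow> h x \<le> h y \<Longrightarrow> h' x \<le> h' y"
  shows "mono_or_antimono_on I h'"
  using assms unfolding mono_or_antimono_on_def monotone_on_def by meson

lemma mono_or_antimono_on_compose:
  assumes "mono_or_antimono_on I h" "mono_on J \<phi>" "\<phi> ` J \<subseteq> I"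
  shows "mono_or_antimono_on J (h \<circ> \<phi>)"
  using assms monotone_on_o[of I _ _ h J] unfolding mono_or_antimono_on_def by blast

lemma mono_or_antimono_on_strict_mono_image:
  assumes "strict_mono_on I e"
  shows "mono_or_antimono_on (e ` I) h \<longleftrightarrow> mono_or_antimono_on I (h \<circ> e)"
proof -
  have "e x \<le> e y \<longleftrightarrow> x \<le> y" if "x \<in> I" "y \<in> I" for x y
    using strict_mono_on_less_eq[OF assms that] .
  then show ?thesis
    by (auto simp: mono_or_antimono_on_def monotone_on_def)
qed

lemma mono_or_antimono_on_reversed:
  assumes h: "mono_or_antimono_on I h" and h': "mono_or_antimono_on I h'"
    and rev: "x \<in> I" "x' \<in> I" "h x < h x'" "h' x' < h' x"
    and yz: "y \<in> I" "z \<in> I" "h y < h z"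
  shows "h' z \<le> h' y"
proof (cases "x < x'")
  case True
  then have "mono_on I h" "antimono_on I h'"
    using h h' rev unfolding mono_or_antimono_on_def monotone_on_def by (meson leD less_imp_le)+
  then show ?thesis
    using yz unfolding monotone_on_def by (meson leD linear)
next
  case False
  then have "antimono_on I h" "mono_on I h'"
    using h h' rev unfolding mono_or_antimono_on_def monotone_on_def by (meson leD leI)+
  then show ?thesis
    using yz unfolding monotone_on_def by (meson leD linear)
qed

lemma finite_mono_sets [simp]: "finite A \<Longrightarrow> finite (mono_sets k A h)"
  by (simp add: mono_sets_def finite_imp_finite_nsets)

lemma mono_sets_subset: "B \<subseteq> A \<Longrightarrow> mono_sets k B h \<subseteq> mono_sets k A h"
  by (auto simp: mono_sets_def nsets_def)

lemma mono_sets_order_preserving: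
  assumes "\<And>x y. x \<in> A \<Longrightarrow> y \<in> A \<Longrightarrow> h x \<le> h y \<Longrightarrow> h' x \<le> h' y"
  shows "mono_sets k A h \<subseteq> mono_sets k A h'"
proof
  fix I assume "I \<in> mono_sets k A h"
  then have I: "I \<in> nsets A k" "I \<subseteq> A" "mono_or_antimono_on I h"
    by (auto simp: mono_sets_def nsets_def)
  then have "mono_or_antimono_on I h'"
    using assms by (blast intro: mono_or_antimono_on_order_preserving)
  with I show "I \<in> mono_sets k A h'"
    by (simp add: mono_sets_def)
qed

lemma mono_sets_strict_mono_compose:
  assumes "strict_mono_on (h ` A) r"
  shows "mono_sets k A (r \<circ> h) = mono_sets k A h"
  by (intro equalityI mono_sets_order_preserving) (simp_all add: strict_mono_on_less_eq[OF assms])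

lemma card_mono_sets_strict_mono_image:
  assumes "strict_mono_on A e"
  shows "card (mono_sets k (e ` A) h) = card (mono_sets k A (h \<circ> e))"
proof -
  have "bij_betw ((`) e) (nsets A k) (nsets (e ` A) k)"
    using assms by (intro bij_betw_nsets inj_on_imp_bij_betw strict_mono_on_imp_inj_on)
  then have "bij_betw ((`) e) (mono_sets k A (h \<circ> e)) (mono_sets k (e ` A) h)"
    unfolding mono_sets_def
  proof (rule bij_betw_Collect)
    fix I assume "I \<in> nsets A k"
    then have "strict_mono_on I e"
      using assms monotone_on_subset by (auto simp: nsets_def)
    then show "mono_or_antimono_on (e ` I) h \<longleftrightarrow> mono_or_antimono_on I (h \<circ> e)"
      by (rule mono_or_antimono_on_strict_mono_image)
  qed
  then show ?thesis
    by (simp add: bij_betw_same_card)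
qed

lemma mono_density_nonneg: "0 \<le> mono_density k A h"
  by (simp add: mono_density_def)

lemma mono_density_le_1:
  assumes "finite A"
  shows "mono_density k A h \<le> 1"
proof -
  have "card (mono_sets k A h) \<le> card (nsets A k)"
    using assms by (intro card_mono finite_imp_finite_nsets) (auto simp: mono_sets_def)
  then show ?thesis
    by (auto simp: mono_density_def intro!: divide_le_eq_1[THEN iffD2])
qed

lemma sum_card_mono_sets_delete:
  assumes "finite A"
  shows "(\<Sum>x\<in>A. card (mono_sets k (A - {x}) h)) = (card A - k) * card (mono_sets k A h)"
proof -
  have "mono_sets k (A - {x}) h = {I \<in> mono_sets k A h. x \<notin> I}" for x
    by (auto simp: mono_sets_def nsets_def)
  then have "(\<Sum>x\<in>A. card (mono_sets k (A - {x}) h)) = (\<Sum>x\<in>A. card {I \<in> mono_sets k A h. x \<notin> I})"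
    by simp
  also have "\<dots> = (\<Sum>I\<in>mono_sets k A h. card A - k)"
  proof (rule sum_multicount_gen)
    show "\<forall>I\<in>mono_sets k A h. card {x \<in> A. x \<notin> I} = card A - k"
      by (auto simp: mono_sets_def nsets_def card_Diff_subset simp flip: set_diff_eq)
  qed (use assms in auto)
  finally show ?thesis
    by simp
qed

lemma le_mono_density_if_le_mono_density_delete:
  assumes A: "finite A" and k: "k < card A"
    and a: "\<And>x. x \<in> A \<Longrightarrow> a \<le> mono_density k (A - {x}) h"
  shows "a \<le> mono_density k A h"
proof -
  let ?n = "card A"
  have "a * real (?n - 1 choose k) \<le> real (card (mono_sets k (A - {x}) h))" if "x \<in> A" for x
    using a[OF that] that A k by (simp add: mono_density_def pos_le_divide_eq)
  then have "(\<Sum>x\<in>A. a * real (?n - 1 choose k)) \<le> (\<Sum>x\<in>A. real (card (mono_sets k (A - {x}) h)))"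
    by (rule sum_mono)
  also have "\<dots> = real (?n - k) * real (card (mono_sets k A h))"
    using sum_card_mono_sets_delete[OF A, of k h] by (metis of_nat_mult of_nat_sum)
  also have "(\<Sum>x\<in>A. a * real (?n - 1 choose k)) = a * real (?n * (?n - 1 choose k))"
    by simp
  also have "\<dots> = real (?n - k) * (a * real (?n choose k))"
    using binomial_absorb_comp[of ?n k] by (metis mult.left_commute of_nat_mult)
  finally have "a * real (?n choose k) \<le> real (card (mono_sets k A h))"
    using k by (simp add: mult_le_cancel_left)
  then show ?thesis
    using k by (simp add: mono_density_def pos_le_divide_eq)
qed

section \<open>Words and permutations as functions on positions\<close>

lemma mono_subwords_eq: "mono_subwords k w = card (mono_sets k {..<length w} ((!) w))"
proof -
  have "finite I" if "I \<subseteq> {..<length w}" for I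
    using that finite_subset by blast
  then have "{I. I \<subseteq> {..<length w} \<and> card I = k \<and> (mono_on I ((!) w) \<or> antimono_on I ((!) w))} =
      mono_sets k {..<length w} ((!) w)"
    unfolding mono_sets_def mono_or_antimono_on_def nsets_def by blast
  then show ?thesis
    by (simp add: mono_subwords_def)
qed

lemma mono_subwords_map_sorted_list_of_set:
  assumes "finite A"
  shows "mono_subwords k (map h (sorted_list_of_set A)) = card (mono_sets k A h)"
proof -
  let ?e = "(!) (sorted_list_of_set A)"
  have "mono_sets k {..<card A} ((!) (map h (sorted_list_of_set A))) =
      mono_sets k {..<card A} (h \<circ> ?e)"
    by (intro equalityI mono_sets_order_preserving) auto
  moreover have "strict_mono_on {..<card A} ?e"
    using sorted_wrt_nth_less[OF strict_sorted_list_of_set[of A]] assms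
    by (auto simp: strict_mono_on_def)
  moreover have "?e ` {..<card A} = A"
    using bij_betw_nth[of "sorted_list_of_set A"] assms by (simp add: bij_betw_def)
  ultimately show ?thesis
    using card_mono_sets_strict_mono_image[of "{..<card A}" ?e k h] by (simp add: mono_subwords_eq)
qed

lemma ex_strict_mono_rank:
  fixes A :: "'a::linorder set"
  assumes "finite A"
  obtains r :: "'a \<Rightarrow> nat" where "strict_mono_on A r" "r ` A = {1..card A}"
proof -
  define r where "r x = card {y \<in> A. y \<le> x}" for x
  have r: "strict_mono_on A r"
  proof (rule strict_mono_onI)
    fix x y assume "x \<in> A" "y \<in> A" "x < y"
    then have "{z \<in> A. z \<le> x} \<subset> {z \<in> A. z \<le> y}"
      by force
    then show "r x < r y"
      unfolding r_def using assms by (intro psubset_card_mono) auto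
  qed
  have "r x \<in> {1..card A}" if "x \<in> A" for x
    using that assms by (auto simp: r_def Suc_le_eq card_gt_0_iff intro: card_mono)
  moreover have "card (r ` A) = card A"
    using strict_mono_on_imp_inj_on[OF r] by (rule card_image)
  ultimately have "r ` A = {1..card A}"
    by (intro card_subset_eq) auto
  with r show thesis
    by (rule that)
qed

lemma finite_words: "finite (words s n)"
  unfolding words_def by (rule finite_lists_length_eq) simp

lemma f_fin_le_mono_density:
  assumes "finite A" "h ` A \<subseteq> {..<s}"
  shows "f_fin s k (card A) \<le> mono_density k A h"
proof -
  have "map h (sorted_list_of_set A) \<in> words s (card A)"
    using assms by (auto simp: words_def)
  then show ?thesis
    unfolding f_fin_def using assms finite_words
    by (intro Min_le) (auto simp: mono_density_def simp flip: mono_subwords_map_sorted_list_of_set)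
qed

lemma f_fin_attained:
  assumes "s \<ge> 1"
  obtains h where "h ` {..<n} \<subseteq> {..<s}" "f_fin s k n = mono_density k {..<n} h"
proof -
  have "replicate n 0 \<in> words s n"
    using assms by (auto simp: words_def)
  then have "f_fin s k n \<in> (\<lambda>w. real (mono_subwords k w) / real (n choose k)) ` words s n"
    unfolding f_fin_def using finite_words by (intro Min_in) auto
  then obtain w where "w \<in> words s n" "f_fin s k n = real (mono_subwords k w) / real (n choose k)"
    by blast
  then show thesis
    using that[of "(!) w"] by (force simp: mono_subwords_eq mono_density_def words_def)
qed

lemma g_fin_le_mono_density:
  fixes h :: "nat \<Rightarrow> 'a::linorder"
  assumes "finite A" "inj_on h A"
  shows "g_fin k (card A) \<le> mono_density k A h"
proof -
  obtain r where r: "strict_mono_on (h ` A) r" "r ` h ` A = {1..card A}"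
    using ex_strict_mono_rank[of "h ` A"] assms by (auto simp: card_image)
  have "inj_on (r \<circ> h) A"
    using assms(2) strict_mono_on_imp_inj_on[OF r(1)] by (rule comp_inj_on)
  then have "map (r \<circ> h) (sorted_list_of_set A) \<in> permutations_of_set {1..card A}"
    using assms(1) r(2) by (simp add: permutations_of_set_def distinct_map image_comp del: map_map)
  then have "g_fin k (card A) \<le> mono_density k A (r \<circ> h)"
    unfolding g_fin_def mono_density_def using assms(1)
    by (intro Min_le) (auto simp flip: mono_subwords_map_sorted_list_of_set simp del: map_map)
  then show ?thesis
    by (simp add: mono_density_def mono_sets_strict_mono_compose[OF r(1)])
qed

lemma g_fin_attained:
  obtains h :: "nat \<Rightarrow> nat" where "inj_on h {..<n}" "g_fin k n = mono_density k {..<n} h"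
proof -
  have "g_fin k n \<in> (\<lambda>w. real (mono_subwords k w) / real (n choose k)) ` permutations_of_set {1..n}"
    unfolding g_fin_def by (intro Min_in) auto
  then obtain w where w: "w \<in> permutations_of_set {1..n}"
      "g_fin k n = real (mono_subwords k w) / real (n choose k)"
    by blast
  have "length w = n" "distinct w"
    using w(1) by (auto simp: permutations_of_set_def dest: distinct_card)
  then show thesis
    using that[of "(!) w"] w(2) by (auto simp: mono_subwords_eq mono_density_def inj_on_nth)
qed

lemma convergent_min_mono_density:
  fixes P :: "nat set \<Rightarrow> (nat \<Rightarrow> 'b::linorder) \<Rightarrow> bool"
  assumes hereditary: "\<And>A B h. P A h \<Longrightarrow> B \<subseteq> A \<Longrightarrow> P B h"
    and lower: "\<And>A h. finite A \<Longrightarrow> P A h \<Longrightarrow> a (card A) \<le> mono_density k A h"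
    and attained: "\<And>n. \<exists>h. P {..<n} h \<and> a n = mono_density k {..<n} h"
  shows "convergent a"
proof -
  have "a n \<le> a (Suc n)" for n
  proof (cases "k \<le> n")
    case True
    obtain h where h: "P {..<Suc n} h" "a (Suc n) = mono_density k {..<Suc n} h"
      using attained by blast
    show ?thesis
      unfolding h(2)
    proof (rule le_mono_density_if_le_mono_density_delete)
      show "a n \<le> mono_density k ({..<Suc n} - {x}) h" if "x \<in> {..<Suc n}" for x
        using lower[OF _ hereditary[OF h(1)], of "{..<Suc n} - {x}"] that by simp
    qed (use True in auto)
  next
    case False
    then have "a n = 0"
      using attained[of n] by (auto simp: mono_density_def)
    then show ?thesis
      using attained[of "Suc n"] mono_density_nonneg by metis
  qed
  moreover have "a n \<le> 1" for n
    using attained[of n] mono_density_le_1[of "{..<n}"] by auto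
  ultimately show ?thesis
    using incseq_convergent[of a 1] incseq_SucI[of a] unfolding convergent_def by metis
qed

lemma f_fin_tendsto_f_lim:
  assumes "s \<ge> 1"
  shows "f_fin s k \<longlonglongrightarrow> f_lim s k"
proof -
  have "convergent (f_fin s k)"
  proof (rule convergent_min_mono_density[where P = "\<lambda>A h. h ` A \<subseteq> {..<s}"])
    show "\<exists>h. h ` {..<n} \<subseteq> {..<s} \<and> f_fin s k n = mono_density k {..<n} h" for n
      using f_fin_attained[OF assms] by metis
  qed (auto intro: f_fin_le_mono_density)
  then show ?thesis
    by (simp add: convergent_LIMSEQ_iff f_lim_def)
qed

lemma g_fin_tendsto_g_lim: "g_fin k \<longlonglongrightarrow> g_lim k"
proof -
  have "convergent (g_fin k)"
  proof (rule convergent_min_mono_density[where P = "\<lambda>A (h :: nat \<Rightarrow> nat). inj_on h A"])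
    show "\<exists>h :: nat \<Rightarrow> nat. inj_on h {..<n} \<and> g_fin k n = mono_density k {..<n} h" for n
      using g_fin_attained by metis
  qed (auto intro: g_fin_le_mono_density inj_on_subset)
  then show ?thesis
    by (simp add: convergent_LIMSEQ_iff g_lim_def)
qed

section \<open>Double counting\<close>

lemma card_mult_le_if_many_inserts:
  assumes fin: "finite \<T>" "finite \<N>"
    and \<N>: "\<And>K. K \<in> \<N> \<Longrightarrow> finite K \<and> card K = k"
    and \<T>: "\<And>I. I \<in> \<T> \<Longrightarrow> t \<le> card {y. y \<notin> I \<and> insert y I \<in> \<N>}"
  shows "card \<T> * t \<le> card \<N> * k"
proof -
  let ?D = "\<lambda>I. {y. y \<notin> I \<and> insert y I \<in> \<N>}"
  have "finite (?D I)" for I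
    by (rule finite_subset[of _ "\<Union>\<N>"]) (use fin \<N> in auto)
  then have "(\<Sum>I\<in>\<T>. card (?D I)) = card (SIGMA I:\<T>. ?D I)"
    using fin by simp
  also have "\<dots> \<le> card (SIGMA K:\<N>. K)"
  proof (rule card_inj_on_le)
    show "inj_on (\<lambda>(I, y). (insert y I, y)) (SIGMA I:\<T>. ?D I)"
      by (auto simp: inj_on_def insert_ident)
  qed (use fin \<N> in auto)
  also have "\<dots> = (\<Sum>K\<in>\<N>. k)"
    using fin \<N> by simp
  finally show ?thesis
    using sum_bounded_below[of \<T> t "\<lambda>I. card (?D I)"] \<T> by simp
qed

lemma card_small_fibres_le:
  assumes "finite A" "finite V" "f ` A \<subseteq> V"
  shows "card {x \<in> A. card {y \<in> A. f y = f x} \<le> t} \<le> card V * t"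
proof -
  let ?F = "\<lambda>v. {x \<in> A. f x = v}"
  let ?U = "\<lambda>v. if card (?F v) \<le> t then ?F v else {}"
  have "{x \<in> A. card (?F (f x)) \<le> t} \<subseteq> (\<Union>v\<in>V. ?U v)"
    using assms(3) by auto
  then have "card {x \<in> A. card (?F (f x)) \<le> t} \<le> card (\<Union>v\<in>V. ?U v)"
    using assms by (intro card_mono) auto
  also have "\<dots> \<le> (\<Sum>v\<in>V. card (?U v))"
    using assms(2) by (rule card_UN_le)
  also have "\<dots> \<le> card V * t"
    using sum_bounded_above[of V "\<lambda>v. card (?U v)" t] by simp
  finally show ?thesis .
qed

context
  fixes X :: "'i set" and B :: "'i \<Rightarrow> 'a set" and b :: "'a \<Rightarrow> 'i" and q :: nat
  assumes X: "finite X" and q: "q > 0"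
    and card_B: "\<And>i. i \<in> X \<Longrightarrow> card (B i) = q"
    and B: "\<And>i x. i \<in> X \<Longrightarrow> x \<in> B i \<Longrightarrow> b x = i"
begin

lemma transversal_determined:
  assumes "\<phi> \<in> PiE X B" "I \<subseteq> \<phi> ` X" "x \<in> I"
  shows "b x \<in> X" and "\<phi> (b x) = x"
  using assms B by fastforce+

lemma inj_on_restrict_transversals_containing:
  "inj_on (\<lambda>\<phi>. restrict \<phi> (X - b ` I)) {\<phi> \<in> PiE X B. I \<subseteq> \<phi> ` X}"
proof (rule inj_onI)
  fix \<phi> \<psi>
  assume \<phi>: "\<phi> \<in> {\<phi> \<in> PiE X B. I \<subseteq> \<phi> ` X}" and \<psi>: "\<psi> \<in> {\<phi> \<in> PiE X B. I \<subseteq> \<phi> ` X}"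
    and eq: "restrict \<phi> (X - b ` I) = restrict \<psi> (X - b ` I)"
  have "\<phi> i = \<psi> i" if "i \<in> X" for i
  proof (cases "i \<in> b ` I")
    case True
    then obtain x where x: "x \<in> I" "i = b x"
      by blast
    have "\<phi> i = x" "\<psi> i = x"
      using \<phi> \<psi> x transversal_determined(2)[of _ I x] by auto
    then show ?thesis
      by simp
  next
    case False
    then show ?thesis
      using fun_cong[OF eq, of i] that by simp
  qed
  then show "\<phi> = \<psi>"
    using \<phi> \<psi> by (intro PiE_ext[of \<phi> X B]) auto
qed

lemma card_transversals_containing_le:
  "card {\<phi> \<in> PiE X B. I \<subseteq> \<phi> ` X} * q ^ card I \<le> q ^ card X"
proof (cases "{\<phi> \<in> PiE X B. I \<subseteq> \<phi> ` X} = {}")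
  case True
  then show ?thesis
    by (simp only: card.empty)
next
  case False
  let ?F = "{\<phi> \<in> PiE X B. I \<subseteq> \<phi> ` X}"
  obtain \<phi> where \<phi>: "\<phi> \<in> PiE X B" "I \<subseteq> \<phi> ` X"
    using False by blast
  have "inj_on b I" and bI: "b ` I \<subseteq> X"
    using transversal_determined[OF \<phi>] by (auto intro: inj_on_inverseI[of _ \<phi>])
  then have card_bI: "card (b ` I) = card I" and "card I \<le> card X"
    using card_mono[OF X bI] by (auto simp: card_image)
  have "card ?F \<le> card (PiE (X - b ` I) B)"
  proof (rule card_inj_on_le[OF inj_on_restrict_transversals_containing])
    show "(\<lambda>\<phi>. restrict \<phi> (X - b ` I)) ` ?F \<subseteq> PiE (X - b ` I) B"
      by (auto simp: restrict_PiE_iff dest: PiE_mem)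
    show "finite (PiE (X - b ` I) B)"
      using X q card_B by (intro finite_PiE) (auto intro: card_ge_0_finite)
  qed
  also have "\<dots> = q ^ (card X - card I)"
    using X bI card_bI card_B by (simp add: card_PiE card_Diff_subset finite_subset)
  finally have "card ?F * q ^ card I \<le> q ^ (card X - card I) * q ^ card I"
    by (rule mult_right_mono) simp
  then show ?thesis
    using \<open>card I \<le> card X\<close> by (simp flip: power_add)
qed

lemma card_ge_if_transversals_contain:
  assumes fin: "finite \<T>" and card_\<T>: "\<And>I. I \<in> \<T> \<Longrightarrow> card I = j"
    and contain: "\<And>\<phi>. \<phi> \<in> PiE X B \<Longrightarrow> \<exists>I\<in>\<T>. I \<subseteq> \<phi> ` X"
  shows "q ^ j \<le> card \<T>"
proof -
  let ?F = "\<lambda>I. {\<phi> \<in> PiE X B. I \<subseteq> \<phi> ` X}"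
  have "PiE X B = (\<Union>I\<in>\<T>. ?F I)"
    using contain by blast
  then have "q ^ card X \<le> (\<Sum>I\<in>\<T>. card (?F I))"
    using card_UN_le[OF fin, of ?F] X card_B by (simp add: card_PiE)
  then have "q ^ card X * q ^ j \<le> (\<Sum>I\<in>\<T>. card (?F I) * q ^ card I)"
    using card_\<T> by (simp flip: sum_distrib_right)
  also have "\<dots> \<le> card \<T> * q ^ card X"
    using sum_bounded_above[of \<T> _ "q ^ card X"] card_transversals_containing_le by simp
  finally show ?thesis
    using q by (simp add: mult.commute)
qed

end

section \<open>Monotone transversals\<close>

definition mono_unavoidable :: "nat \<Rightarrow> nat \<Rightarrow> bool" where
  "mono_unavoidable k M \<longleftrightarrow>
    (\<forall>(A :: nat set) (h :: nat \<Rightarrow> nat). finite A \<longrightarrow> card A = M \<longrightarrow> mono_sets k A h \<noteq> {})"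

lemma ex_mono_unavoidable: "\<exists>M. mono_unavoidable k M"
proof -
  obtain M where M: "\<And>(V :: nat set) E. finite V \<Longrightarrow> card V \<ge> M \<Longrightarrow>
      \<exists>R \<subseteq> V. card R = k \<and> clique R E \<or> card R = k \<and> indep R E"
    using ramsey2[of k k] by metis
  have "mono_sets k A h \<noteq> {}" if A: "finite A" "card A = M" for A and h :: "nat \<Rightarrow> nat"
  proof -
    define E where "E = {{x, y} | x y. x < y \<and> h x \<le> h y}"
    have E: "{x, y} \<in> E \<longleftrightarrow> h x \<le> h y" if "x < y" for x y
      using that by (auto simp: E_def doubleton_eq_iff)
    obtain R where R: "R \<subseteq> A" "card R = k" "clique R E \<or> indep R E"
      using M[of A E] A by auto
    have "mono_on R h" if "clique R E"
      using that E unfolding clique_def monotone_on_def by (metis nat_less_le order_refl)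
    moreover have "antimono_on R h" if "indep R E"
      using that E unfolding indep_def monotone_on_def by (metis nat_le_linear nat_less_le)
    ultimately have "R \<in> mono_sets k A h"
      using R A finite_subset by (auto simp: mono_sets_def nsets_def mono_or_antimono_on_def)
    then show ?thesis
      by blast
  qed
  then show ?thesis
    unfolding mono_unavoidable_def by blast
qed

lemma mono_unavoidable_imp_le:
  assumes "mono_unavoidable k M"
  shows "k \<le> M"
proof -
  have "mono_sets k {..<M} (\<lambda>x. x) \<noteq> {}"
    using assms by (auto simp: mono_unavoidable_def)
  then show ?thesis
    using card_mono[of "{..<M}"] by (fastforce simp: mono_sets_def nsets_def)
qed

lemma card_transversal_mono_sets_ge:
  fixes b w :: "nat \<Rightarrow> nat"
  assumes M: "mono_unavoidable k M" and "finite G" and "q > 0"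
    and q: "\<And>i. i < M \<Longrightarrow> q \<le> card {x \<in> G. b x = i}"
  shows "q ^ k \<le> card {I \<in> mono_sets k G w. inj_on b I}"
proof -
  have "\<forall>i<M. \<exists>B \<subseteq> {x \<in> G. b x = i}. card B = q"
    using q by (meson obtain_subset_with_card_n)
  then obtain B where B: "\<And>i. i < M \<Longrightarrow> B i \<subseteq> {x \<in> G. b x = i}" "\<And>i. i < M \<Longrightarrow> card (B i) = q"
    by metis
  show ?thesis
  proof (rule card_ge_if_transversals_contain[of "{..<M}" q B b])
    fix \<phi> assume "\<phi> \<in> PiE {..<M} B"
    then have \<phi>: "\<phi> i \<in> G \<and> b (\<phi> i) = i" if "i < M" for i
      using B(1) that by blast
    have "inj_on \<phi> {..<M}"
      using \<phi> by (auto intro: inj_on_inverseI)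
    then have "mono_sets k (\<phi> ` {..<M}) w \<noteq> {}"
      using M by (simp add: mono_unavoidable_def card_image)
    then obtain I where I: "I \<in> mono_sets k (\<phi> ` {..<M}) w"
      by blast
    then have sub: "I \<subseteq> \<phi> ` {..<M}"
      by (auto simp: mono_sets_def nsets_def)
    have "inj_on b (\<phi> ` {..<M})"
      using \<phi> by (auto intro: inj_on_inverseI[of _ \<phi>])
    then have "inj_on b I"
      using sub by (rule inj_on_subset)
    moreover have "I \<in> mono_sets k G w"
      using I mono_sets_subset[of "\<phi> ` {..<M}" G] \<phi> by blast
    ultimately show "\<exists>I\<in>{I \<in> mono_sets k G w. inj_on b I}. I \<subseteq> \<phi> ` {..<M}"
      using sub by blast
  qed (use assms B in \<open>auto simp: mono_sets_def nsets_def\<close>)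
qed

section \<open>Sets broken by tie-breaking\<close>

text \<open>The function \<open>b\<close> maps a position to its block.\<close>

definition tie_broken_sets :: "nat \<Rightarrow> nat set \<Rightarrow> (nat \<Rightarrow> nat) \<Rightarrow> (nat \<Rightarrow> nat) \<Rightarrow> nat set set" where
  "tie_broken_sets k A b w = mono_sets k A w -
    mono_sets k A (\<lambda>x. (w x, x)) \<inter> mono_sets k A (\<lambda>x. (w x, b x, - int x))"

definition twins :: "nat set \<Rightarrow> (nat \<Rightarrow> nat) \<Rightarrow> (nat \<Rightarrow> nat) \<Rightarrow> nat \<Rightarrow> nat set" where
  "twins A b w x = {y \<in> A. b y = b x \<and> w y = w x} - {x}"

lemma mono_sets_lex_subset: "mono_sets k A (\<lambda>x. (w x, p x)) \<subseteq> mono_sets k A w"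
  by (rule mono_sets_order_preserving) (auto simp: less_eq_prod_def)

lemma g_fin_add_tie_broken_le:
  assumes A: "finite A"
  shows "g_fin k (card A) + real (card (tie_broken_sets k A b w)) / (2 * real (card A choose k))
    \<le> mono_density k A w"
proof -
  let ?N = "mono_sets k A w" and ?N1 = "mono_sets k A (\<lambda>x. (w x, x))"
    and ?N2 = "mono_sets k A (\<lambda>x. (w x, b x, - int x))" and ?C = "real (card A choose k)"
  have sub: "?N1 \<union> ?N2 \<subseteq> ?N"
    by (intro Un_least mono_sets_lex_subset)
  have "card ?N1 + card ?N2 = card (?N1 \<union> ?N2) + card (?N1 \<inter> ?N2)"
    using A by (intro card_Un_Int) auto
  also have "\<dots> \<le> card ?N + card (?N1 \<inter> ?N2)"
    using A sub by (intro add_right_mono card_mono) auto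
  finally have "card ?N1 + card ?N2 \<le> card ?N + card (?N1 \<inter> ?N2)" .
  moreover have "card (tie_broken_sets k A b w) = card ?N - card (?N1 \<inter> ?N2)"
    unfolding tie_broken_sets_def using A sub by (intro card_Diff_subset) auto
  moreover have "card (?N1 \<inter> ?N2) \<le> card ?N"
    using A sub by (intro card_mono) auto
  ultimately have "card ?N1 + card ?N2 + card (tie_broken_sets k A b w) \<le> 2 * card ?N"
    by linarith
  then have "real (card ?N1 + card ?N2 + card (tie_broken_sets k A b w)) / ?C \<le> real (2 * card ?N) / ?C"
    by (intro divide_right_mono of_nat_mono) auto
  moreover have "g_fin k (card A) \<le> mono_density k A (\<lambda>x. (w x, x))"
      "g_fin k (card A) \<le> mono_density k A (\<lambda>x. (w x, b x, - int x))"
    using A by (intro g_fin_le_mono_density; simp add: inj_on_def)+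
  ultimately show ?thesis
    by (simp add: mono_density_def add_divide_distrib)
qed

lemma not_mono_or_antimono_on_both_tie_breaks:
  fixes b w :: "nat \<Rightarrow> nat"
  assumes b: "mono b" and I: "x \<in> I" "y \<in> I" "z \<in> I"
    and xy: "x \<noteq> y" "b y = b x" "w y = w x" and z: "b z \<noteq> b x"
    and asc: "mono_or_antimono_on I (\<lambda>x. (w x, x))"
  shows "\<not> mono_or_antimono_on I (\<lambda>x. (w x, b x, - int x))"
proof
  let ?h = "\<lambda>x. (w x, x)" and ?h' = "\<lambda>x. (w x, b x, - int x)"
  assume "mono_or_antimono_on I ?h'"
  moreover obtain u v where "u \<in> I" "v \<in> I" "?h u < ?h v" "?h' v < ?h' u"
    using I xy by (cases "x < y") auto
  ultimately have reversed: "?h' q \<le> ?h' p" if "p \<in> I" "q \<in> I" "?h p < ?h q" for p q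
    using mono_or_antimono_on_reversed[OF asc] that by blast
  have "x < z \<and> b x < b z \<or> z < x \<and> b z < b x"
    using z monoD[OF b, of x z] monoD[OF b, of z x] by linarith
  then consider "?h x < ?h z \<and> ?h' x < ?h' z" | "?h z < ?h x \<and> ?h' z < ?h' x"
    by (cases "w x" "w z" rule: linorder_cases) auto
  then show False
    using reversed I by cases (meson leD)+
qed

lemma mono_or_antimono_on_insert_twin:
  fixes b :: "'a::linorder \<Rightarrow> 'i::linorder"
  assumes b: "mono b" and I: "mono_or_antimono_on I w" "inj_on b I" "x \<in> I"
    and y: "b y = b x" "w y = w x"
  shows "mono_or_antimono_on (insert y I) w"
proof -
  let ?\<phi> = "id(y := x)"
  have between: "v = x" if v: "v \<in> I" "x \<le> v \<and> v \<le> y \<or> y \<le> v \<and> v \<le> x" for v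
  proof -
    have "b v = b x"
      using v(2) monoD[OF b] y(1) by (metis order.antisym)
    then show ?thesis
      using I v(1) by (auto dest: inj_onD)
  qed
  have "mono_on (insert y I) ?\<phi>"
  proof (rule monotone_onI)
    fix u v assume "u \<in> insert y I" "v \<in> insert y I" "u \<le> v"
    then show "?\<phi> u \<le> ?\<phi> v"
      using between[of u] between[of v] by auto (metis linear)+
  qed
  then have "mono_or_antimono_on (insert y I) (w \<circ> ?\<phi>)"
    using I by (intro mono_or_antimono_on_compose[OF I(1)]) auto
  moreover have "w \<circ> ?\<phi> = w"
    using y(2) by auto
  ultimately show ?thesis
    by simp
qed

lemma insert_twin_in_tie_broken_sets:
  assumes b: "mono b" and I: "I \<in> mono_sets k A w" "inj_on b I" and k: "k \<ge> 2"
    and x: "x \<in> I" and y: "y \<in> twins A b w x"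
  shows "y \<notin> I" and "insert y I \<in> tie_broken_sets (Suc k) A b w"
proof -
  have I': "I \<subseteq> A" "finite I" "card I = k" "mono_or_antimono_on I w"
    using I(1) by (auto simp: mono_sets_def nsets_def)
  have y': "y \<in> A" "b y = b x" "w y = w x" "x \<noteq> y"
    using y by (auto simp: twins_def)
  show "y \<notin> I"
    using y' x I(2) by (auto dest: inj_onD)
  moreover have "mono_or_antimono_on (insert y I) w"
    using b I'(4) I(2) x y'(2,3) by (rule mono_or_antimono_on_insert_twin)
  ultimately have mono: "insert y I \<in> mono_sets (Suc k) A w"
    using I' y'(1) by (simp add: mono_sets_def nsets_def)
  have "I \<noteq> {x}"
    using I'(3) k by auto
  then obtain z where z: "z \<in> I" "z \<noteq> x"
    using x by blast
  then have "b z \<noteq> b x"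
    using x I(2) by (auto dest: inj_onD)
  then show "insert y I \<in> tie_broken_sets (Suc k) A b w"
    using mono not_mono_or_antimono_on_both_tie_breaks[OF b, of x "insert y I" y z w] x y' z
    by (auto simp: tie_broken_sets_def mono_sets_def)
qed

lemma card_twins_le_card_inserts:
  assumes "finite A" "mono b" "I \<in> mono_sets k A w" "inj_on b I" "k \<ge> 2" "x \<in> I"
  shows "card (twins A b w x) \<le> card {y. y \<notin> I \<and> insert y I \<in> tie_broken_sets (Suc k) A b w}"
proof (rule card_mono)
  show "finite {y. y \<notin> I \<and> insert y I \<in> tie_broken_sets (Suc k) A b w}"
    by (rule finite_subset[OF _ assms(1)]) (auto simp: tie_broken_sets_def mono_sets_def nsets_def)
  show "twins A b w x \<subseteq> {y. y \<notin> I \<and> insert y I \<in> tie_broken_sets (Suc k) A b w}"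
    using insert_twin_in_tie_broken_sets[OF assms(2-)] by blast
qed

lemma card_many_twins_ge:
  assumes "finite A" "w ` A \<subseteq> {..<s}" "2 * s * t \<le> card {x \<in> A. b x = i}"
  shows "s * t \<le> card {x \<in> A. b x = i \<and> t \<le> card (twins A b w x)}"
proof -
  let ?B = "{x \<in> A. b x = i}"
  let ?S = "{x \<in> ?B. card {y \<in> ?B. w y = w x} \<le> t}"
  have "t \<le> card (twins A b w x)" if "x \<in> ?B - ?S" for x
  proof -
    have "twins A b w x = {y \<in> ?B. w y = w x} - {x}"
      using that by (auto simp: twins_def)
    moreover have "x \<in> {y \<in> ?B. w y = w x}" "t < card {y \<in> ?B. w y = w x}"
      using that by (auto simp: not_le)
    ultimately show ?thesis
      by (simp only: card_Diff_singleton)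
  qed
  then have "?B - ?S \<subseteq> {x \<in> A. b x = i \<and> t \<le> card (twins A b w x)}"
    by blast
  then have "card (?B - ?S) \<le> card {x \<in> A. b x = i \<and> t \<le> card (twins A b w x)}"
    using assms(1) by (intro card_mono) auto
  moreover have "card (?B - ?S) = card ?B - card ?S"
    using assms(1) by (intro card_Diff_subset) auto
  moreover have "card ?S \<le> s * t"
    using card_small_fibres_le[of ?B "{..<s}" w t] assms by auto
  ultimately show ?thesis
    using assms(3) by linarith
qed

lemma card_tie_broken_sets_ge:
  fixes b w :: "nat \<Rightarrow> nat"
  assumes M: "mono_unavoidable k M" and k: "k \<ge> 2" and st: "s > 0" "t > 0"
    and A: "finite A" "w ` A \<subseteq> {..<s}" and b: "mono b"
    and blocks: "\<And>i. i < M \<Longrightarrow> 2 * s * t \<le> card {x \<in> A. b x = i}"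
  shows "(s * t) ^ k * t \<le> card (tie_broken_sets (Suc k) A b w) * Suc k"
proof -
  let ?\<N> = "tie_broken_sets (Suc k) A b w"
  define G where "G = {x \<in> A. t \<le> card (twins A b w x)}"
  define \<T> where "\<T> = {I \<in> mono_sets k G w. inj_on b I}"
  have G: "finite G" "G \<subseteq> A"
    using A(1) by (auto simp: G_def)
  have "{x \<in> G. b x = i} = {x \<in> A. b x = i \<and> t \<le> card (twins A b w x)}" for i
    by (auto simp: G_def)
  then have "s * t \<le> card {x \<in> G. b x = i}" if "i < M" for i
    using card_many_twins_ge[OF A blocks[OF that]] by simp
  then have "(s * t) ^ k \<le> card \<T>"
    unfolding \<T>_def using M G(1) st by (intro card_transversal_mono_sets_ge) auto
  then have "(s * t) ^ k * t \<le> card \<T> * t"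
    by simp
  also have "\<dots> \<le> card ?\<N> * Suc k"
  proof (rule card_mult_le_if_many_inserts)
    show "finite \<T>" "finite ?\<N>"
      using G(1) A(1) by (auto simp: \<T>_def tie_broken_sets_def)
    show "finite K \<and> card K = Suc k" if "K \<in> ?\<N>" for K
      using that by (auto simp: tie_broken_sets_def mono_sets_def nsets_def)
    fix I assume "I \<in> \<T>"
    then have I: "I \<in> mono_sets k A w" "inj_on b I" "I \<subseteq> G" "card I = k"
      using mono_sets_subset[OF G(2)] by (auto simp: \<T>_def mono_sets_def nsets_def)
    then obtain x where x: "x \<in> I"
      using k by fastforce
    then have "t \<le> card (twins A b w x)"
      using I(3) by (auto simp: G_def)
    also have "\<dots> \<le> card {y. y \<notin> I \<and> insert y I \<in> ?\<N>}"
      using A(1) b I(1,2) k x by (rule card_twins_le_card_inserts)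
    finally show "t \<le> card {y. y \<notin> I \<and> insert y I \<in> ?\<N>}" .
  qed
  finally show ?thesis .
qed

lemma card_div_block:
  assumes "i < M"
  shows "card {x \<in> {..<M * L}. x div L = i} = L"
proof (cases "L = 0")
  case False
  have "x < M * L \<and> x div L = i \<longleftrightarrow> i * L \<le> x \<and> x < Suc i * L" for x
  proof -
    have "x < M * L \<and> x div L = i \<longleftrightarrow> i \<le> x div L \<and> x div L < Suc i"
      using assms False by (auto simp flip: div_less_iff_less_mult)
    then show ?thesis
      using False by (simp only: less_eq_div_iff_mult_less_eq div_less_iff_less_mult)
  qed
  then have "{x \<in> {..<M * L}. x div L = i} = {i * L..<Suc i * L}"
    by (simp only: set_eq_iff mem_Collect_eq lessThan_iff atLeastLessThan_iff) simp
  then show ?thesis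
    by simp
qed simp

lemma binomial_le_card_tie_broken_sets:
  assumes M: "mono_unavoidable k M" and k: "k \<ge> 2" and st: "s \<ge> 1" "t \<ge> 1"
  defines "n \<equiv> M * (2 * s * t)"
  assumes n: "Suc k \<le> n" and w: "w ` {..<n} \<subseteq> {..<s}"
  shows "n choose Suc k \<le> Suc k * (2 * M) ^ Suc k * s *
    card (tie_broken_sets (Suc k) {..<n} (\<lambda>x. x div (2 * s * t)) w)"
proof -
  let ?N = "tie_broken_sets (Suc k) {..<n} (\<lambda>x. x div (2 * s * t)) w"
  have N: "(s * t) ^ k * t \<le> card ?N * Suc k"
  proof (rule card_tie_broken_sets_ge[OF M k])
    show "mono (\<lambda>x. x div (2 * s * t))"
      by (intro monoI div_le_mono)
    show "2 * s * t \<le> card {x \<in> {..<n}. x div (2 * s * t) = i}" if "i < M" for i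
      using card_div_block[OF that] by (simp add: n_def)
  qed (use st w in auto)
  have "n choose Suc k \<le> n ^ Suc k"
    using n by (rule binomial_le_pow)
  also have "\<dots> = (2 * M) ^ Suc k * s * ((s * t) ^ k * t)"
    by (simp add: n_def power_mult_distrib)
  also have "\<dots> \<le> (2 * M) ^ Suc k * s * (card ?N * Suc k)"
    using N by (rule mult_le_mono2)
  finally show ?thesis
    by (simp only: mult_ac)
qed

lemma f_fin_ge_g_fin_add:
  assumes M: "mono_unavoidable k M" and k: "k \<ge> 2" and st: "s \<ge> 1" "t \<ge> 1"
  defines "n \<equiv> M * (2 * s * t)"
  shows "g_fin (Suc k) n + 1 / (2 * real (Suc k * (2 * M) ^ Suc k)) / real s \<le> f_fin s (Suc k) n"
proof -
  obtain w where w: "w ` {..<n} \<subseteq> {..<s}" "f_fin s (Suc k) n = mono_density (Suc k) {..<n} w"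
    using f_fin_attained[OF st(1)] .
  let ?b = "\<lambda>x. x div (2 * s * t)"
  let ?N = "card (tie_broken_sets (Suc k) {..<n} ?b w)"
    and ?C = "n choose Suc k" and ?K = "Suc k * (2 * M) ^ Suc k * s"
  have "k \<le> M"
    using M by (rule mono_unavoidable_imp_le)
  then have "Suc k \<le> M * 2"
    using k by linarith
  also have "\<dots> \<le> n"
    using st by (simp add: n_def)
  finally have "Suc k \<le> n" .
  then have "?C \<le> ?K * ?N"
    using M k st w(1) unfolding n_def by (intro binomial_le_card_tie_broken_sets)
  then have "real ?C \<le> real (?K * ?N)"
    by (rule of_nat_mono)
  moreover have "?C > 0" "?K > 0"
    using \<open>Suc k \<le> n\<close> \<open>k \<le> M\<close> k st(1) by simp_all
  ultimately have "1 / (2 * real ?K) \<le> real ?N / (2 * real ?C)"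
    by (simp add: field_simps del: of_nat_Suc mult_Suc power_Suc binomial_Suc_Suc)
  also have "g_fin (Suc k) n + real ?N / (2 * real ?C) \<le> f_fin s (Suc k) n"
    using g_fin_add_tie_broken_le[of "{..<n}" "Suc k" ?b w] by (simp add: w(2))
  finally show ?thesis
    by (simp only: of_nat_mult mult.assoc divide_divide_eq_left)
qed

lemma f_lim_ge_g_lim_add:
  assumes M: "mono_unavoidable k M" and k: "k \<ge> 2" and s: "s \<ge> 1"
  shows "g_lim (Suc k) + 1 / (2 * real (Suc k * (2 * M) ^ Suc k)) / real s \<le> f_lim s (Suc k)"
    (is "_ + ?c \<le> _")
proof (rule LIMSEQ_le)
  let ?n = "\<lambda>t. M * (2 * s * t)"
  have n: "strict_mono ?n"
    using mono_unavoidable_imp_le[OF M] k s by (auto simp: strict_mono_def)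
  show "(\<lambda>t. g_fin (Suc k) (?n t) + ?c) \<longlonglongrightarrow> g_lim (Suc k) + ?c"
    using LIMSEQ_subseq_LIMSEQ[OF g_fin_tendsto_g_lim n] by (intro tendsto_intros) (simp add: o_def)
  show "(\<lambda>t. f_fin s (Suc k) (?n t)) \<longlonglongrightarrow> f_lim s (Suc k)"
    using LIMSEQ_subseq_LIMSEQ[OF f_fin_tendsto_f_lim[OF s] n] by (simp add: o_def)
  show "\<exists>t0. \<forall>t\<ge>t0. g_fin (Suc k) (?n t) + ?c \<le> f_fin s (Suc k) (?n t)"
    using f_fin_ge_g_fin_add[OF M k s] by blast
qed

theorem theorem5p1:
  fixes k :: nat
  assumes "k \<ge> 3"
  shows "\<exists>c::real. c > 0 \<and> (\<forall>s::nat. s \<ge> 1 \<longrightarrow> f_lim s k \<ge> g_lim k + c / real s)"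
proof -
  obtain j where k: "k = Suc j" and j: "j \<ge> 2"
    using assms by (cases k) auto
  obtain M where M: "mono_unavoidable j M"
    using ex_mono_unavoidable by blast
  define c where "c = 1 / (2 * real (k * (2 * M) ^ k))"
  have "M > 0"
    using mono_unavoidable_imp_le[OF M] j by simp
  then have "c > 0"
    using assms by (simp add: c_def)
  moreover have "g_lim k + c / real s \<le> f_lim s k" if "s \<ge> 1" for s
    using f_lim_ge_g_lim_add[OF M j that] by (simp only: c_def k)
  ultimately show ?thesis
    by blast
qed

end
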